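(* Two boolean $\mathcal{C}$-algebras $\mathcal{B}_1,\mathcal{B}_2$ are geometrically equivalent if and only if the following two conditions hold: (1) any system of equations that is inconsistent over $\mathcal{B}_1$ is inconsistent over $\mathcal{B}_2$, and vice versa; (2) for any set of constants $\{\mathbf{c}_j\mid j\in J\}\subseteq\mathcal{C}$, the infimum of this set exists and equals $0$ in $\mathcal{B}_1$ if and only if the infimum of the same set exists and equals $0$ in $\mathcal{B}_2$.
   Context: Language. Let $\mathcal{L}=\{\vee,\cdot,\bar{\ },0,1\}\cup\{\mathbf{c}_i\mid i\in I\}$ be the language of boolean algebras (disjunction, conjunction, negation, $0$, $1$) extended by an arbitrary (possibly infinite) set of constant symbols. A boolean $\mathcal{C}$-algebra is a boolean algebra $\mathcal{B}$ regarded as a structure of the language $\mathcal{L}$, where $\mathcal{C}\subseteq\mathcal{B}$ denotes the boolean subalgebra generated by (the interpretations of) the constants $\mathbf{c}_i$, $i\in I$. Standing assumption: $\mathcal{B}_1$ and $\mathcal{B}_2$ have the same subalgebra $\mathcal{C}$ generated by the constants of $\mathcal{L}$; i.e. the subalgebras generated by the constants in $\mathcal{B}_1$ and $\mathcal{B}_2$ are isomorphic as $\mathcal{L}$-structures (the isomorphism sends the interpretation of each $\mathbf{c}_i$ to the interpretation of $\mathbf{c}_i$) and are identified. The partial order is $x\le y\iff xy=x$. Equations. For a finite set of variables $X=\{x_1,\dots,x_n\}$, an equation is an atomic formula $\tau(X)=\sigma(X)$, where $\tau,\sigma$ are $\mathcal{L}$-terms in $X$. A system is an arbitrary (possibly infinite)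 set of equations in a common finite set of variables. $V_{\mathcal{B}}(\mathcal{S})\subseteq\mathcal{B}^n$ denotes the solution set of $\mathcal{S}$ in $\mathcal{B}$; $\mathcal{S}$ is inconsistent over $\mathcal{B}$ if $V_{\mathcal{B}}(\mathcal{S})=\emptyset$. Radical and geometric equivalence. The radical $\mathrm{Rad}_{\mathcal{B}}(\mathcal{S})$ of a system $\mathcal{S}$ in variables $X$ is the set of all equations $\tau(X)=\sigma(X)$ such that $V_{\mathcal{B}}(\mathcal{S})\subseteq V_{\mathcal{B}}(\tau(X)=\sigma(X))$. $\mathcal{B}_1,\mathcal{B}_2$ are geometrically equivalent if $\mathrm{Rad}_{\mathcal{B}_1}(\mathcal{S})=\mathrm{Rad}_{\mathcal{B}_2}(\mathcal{S})$ for every system $\mathcal{S}$. *)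

theory Defs
  imports Main "HOL-Library.FuncSet" "HOL-Library.Lub_Glb"
begin

text \<open>
  A boolean algebra is a type of class \<^class>\<open>boolean_algebra\<close>. Its structure in the language
  with constant symbols \<open>I\<close> is given by an interpretation \<open>c\<close> of the symbols; only the values of
  \<open>c\<close> on \<open>I\<close> matter. Taking \<open>I\<close> to be a set, and not a whole type, allows it to be empty.
\<close>

datatype (tvars: 'v, tconsts: 'i) bterm =
    TVar 'v
  | TConst 'i
  | TZero
  | TOne
  | TOr "('v, 'i) bterm" "('v, 'i) bterm"
  | TAnd "('v, 'i) bterm" "('v, 'i) bterm"
  | TNot "('v, 'i) bterm"

primrec eval_term :: "('i \<Rightarrow> 'a::boolean_algebra) \<Rightarrow> ('v \<Rightarrow> 'a) \<Rightarrow> ('v, 'i) bterm \<Rightarrow> 'a" where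
  "eval_term c p (TVar x) = p x"
| "eval_term c p (TConst i) = c i"
| "eval_term c p TZero = bot"
| "eval_term c p TOne = top"
| "eval_term c p (TOr t s) = sup (eval_term c p t) (eval_term c p s)"
| "eval_term c p (TAnd t s) = inf (eval_term c p t) (eval_term c p s)"
| "eval_term c p (TNot t) = - eval_term c p t"

text \<open>Variables are natural numbers, so that finite variable sets of every size are available.\<close>

type_synonym 'i equation = "(nat, 'i) bterm \<times> (nat, 'i) bterm"

definition terms_in :: "'i set \<Rightarrow> nat set \<Rightarrow> (nat, 'i) bterm set" where
  "terms_in I X = {t. tvars t \<subseteq> X \<and> tconsts t \<subseteq> I}"

definition equations_in :: "'i set \<Rightarrow> nat set \<Rightarrow> 'i equation set" where
  "equations_in I X = terms_in I X \<times> terms_in I X"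

definition is_system :: "'i set \<Rightarrow> nat set \<Rightarrow> 'i equation set \<Rightarrow> bool" where
  "is_system I X S \<longleftrightarrow> finite X \<and> S \<subseteq> equations_in I X"

text \<open>
  Points of \<open>B\<^sup>n\<close> are functions on the variable set \<open>X\<close>, extended by \<^const>\<open>undefined\<close>
  outside \<open>X\<close>.
\<close>

definition solutions ::
    "('i \<Rightarrow> 'a::boolean_algebra) \<Rightarrow> nat set \<Rightarrow> 'i equation set \<Rightarrow> (nat \<Rightarrow> 'a) set" where
  "solutions c X S = {p \<in> X \<rightarrow>\<^sub>E UNIV. \<forall>(t, s)\<in>S. eval_term c p t = eval_term c p s}"

definition inconsistent ::
    "('i \<Rightarrow> 'a::boolean_algebra) \<Rightarrow> nat set \<Rightarrow> 'i equation set \<Rightarrow> bool" where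
  "inconsistent c X S \<longleftrightarrow> solutions c X S = {}"

definition radical ::
    "'i set \<Rightarrow> ('i \<Rightarrow> 'a::boolean_algebra) \<Rightarrow> nat set \<Rightarrow> 'i equation set \<Rightarrow> 'i equation set" where
  "radical I c X S = {e \<in> equations_in I X. solutions c X S \<subseteq> solutions c X {e}}"

definition geometrically_equivalent ::
    "'i set \<Rightarrow> ('i \<Rightarrow> 'a::boolean_algebra) \<Rightarrow> ('i \<Rightarrow> 'b::boolean_algebra) \<Rightarrow> bool" where
  "geometrically_equivalent I c1 c2 \<longleftrightarrow>
     (\<forall>X S. is_system I X S \<longrightarrow> radical I c1 X S = radical I c2 X S)"

inductive_set generated_subalgebra :: "'a::boolean_algebra set \<Rightarrow> 'a set" for A where
  gen_base: "a \<in> A \<Longrightarrow> a \<in> generated_subalgebra A"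
| gen_bot: "bot \<in> generated_subalgebra A"
| gen_top: "top \<in> generated_subalgebra A"
| gen_sup: "a \<in> generated_subalgebra A \<Longrightarrow> b \<in> generated_subalgebra A \<Longrightarrow>
    sup a b \<in> generated_subalgebra A"
| gen_inf: "a \<in> generated_subalgebra A \<Longrightarrow> b \<in> generated_subalgebra A \<Longrightarrow>
    inf a b \<in> generated_subalgebra A"
| gen_compl: "a \<in> generated_subalgebra A \<Longrightarrow> - a \<in> generated_subalgebra A"

text \<open>The subalgebra of constants, written with a calligraphic C in the literature.\<close>

definition const_subalgebra :: "'i set \<Rightarrow> ('i \<Rightarrow> 'a::boolean_algebra) \<Rightarrow> 'a set" where
  "const_subalgebra I c = generated_subalgebra (c ` I)"

text \<open>
  The identification of the two subalgebras of constants. Such an \<open>h\<close> is unique on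
  \<open>const_subalgebra I c1\<close> if it exists.
\<close>

definition const_isomorphism ::
    "'i set \<Rightarrow> ('i \<Rightarrow> 'a::boolean_algebra) \<Rightarrow> ('i \<Rightarrow> 'b::boolean_algebra) \<Rightarrow> ('a \<Rightarrow> 'b) \<Rightarrow> bool" where
  "const_isomorphism I c1 c2 h \<longleftrightarrow>
     bij_betw h (const_subalgebra I c1) (const_subalgebra I c2) \<and>
     (\<forall>i\<in>I. h (c1 i) = c2 i) \<and>
     h bot = bot \<and> h top = top \<and>
     (\<forall>a\<in>const_subalgebra I c1. \<forall>b\<in>const_subalgebra I c1. h (sup a b) = sup (h a) (h b)) \<and>
     (\<forall>a\<in>const_subalgebra I c1. \<forall>b\<in>const_subalgebra I c1. h (inf a b) = inf (h a) (h b)) \<and>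
     (\<forall>a\<in>const_subalgebra I c1. h (- a) = - h a)"

end

theory Submission
  imports Defs
begin

text \<open>
  The value of a term on a part \<open>u\<close> of a boolean algebra depends only on the values of the
  variables on \<open>u\<close>, and every nonzero element has a nonzero part on which finitely many given
  elements are all \<open>0\<close> or \<open>1\<close>. So if a solution \<open>p\<close> of a system in one algebra violates an
  equation, it does so on a nonzero part \<open>u\<close> where \<open>p\<close> is a 0-1 vector \<open>\<alpha>\<close>. That such a \<open>u\<close> exists
  says that a certain set of constants does not have infimum \<open>0\<close>. By (2) the other algebra has such
  a \<open>u\<close> as well, and by (1) it has a solution of the system; overwriting that solution by \<open>\<alpha>\<close> on \<open>u\<close>
  yields a solution that violates the equation.
\<close>

section \<open>Elements of a boolean algebra restricted to a part\<close>

lemma isGlb_UNIV_bot_iff: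
  fixes D :: "'a::boolean_algebra set"
  shows "isGlb UNIV D bot \<longleftrightarrow> (\<forall>u. (\<forall>d\<in>D. u \<le> d) \<longrightarrow> u = bot)"
  by (auto simp: isGlb_def greatestP_def isLb_def setle_def setge_def le_bot)

lemma eq_if_inf_eq_both_parts:
  fixes a b u :: "'a::boolean_algebra"
  assumes "inf a u = inf b u" "inf a (- u) = inf b (- u)"
  shows "a = b"
proof -
  have "x = sup (inf x u) (inf x (- u))" for x :: 'a
    by (simp flip: inf_sup_distrib1)
  then show ?thesis using assms by metis
qed

lemma inf_compl_cong:
  fixes a b u :: "'a::boolean_algebra"
  assumes "inf a u = inf b u"
  shows "inf (- a) u = inf (- b) u"
proof -
  have "inf (- x) u = inf (- (inf x u)) u" for x :: 'a
    by (simp add: inf_sup_distrib2)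
  then show ?thesis using assms by metis
qed

text \<open>The join on the left is the complement of the symmetric difference of \<open>a\<close>
  and \<open>b\<close>, hence the largest part on which they agree.\<close>

lemma le_biimplication_iff:
  fixes a b u :: "'a::boolean_algebra"
  shows "u \<le> sup (inf a b) (inf (- a) (- b)) \<longleftrightarrow> inf a u = inf b u"
proof
  assume le: "u \<le> sup (inf a b) (inf (- a) (- b))"
  have "inf a u = inf a (inf (sup (inf a b) (inf (- a) (- b))) u)"
    using le by (simp add: inf_absorb2)
  also have "\<dots> = inf (inf a b) u"
    by (simp add: inf_sup_distrib1 inf_sup_distrib2 inf.assoc[symmetric])
  also have "\<dots> = inf b (inf (sup (inf a b) (inf (- a) (- b))) u)"
    by (simp add: inf_sup_distrib1 inf_sup_distrib2 inf_commute inf_left_commute)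
  also have "\<dots> = inf b u"
    using le by (simp add: inf_absorb2)
  finally show "inf a u = inf b u" .
next
  assume eq: "inf a u = inf b u"
  have "inf a u \<le> inf a b"
    using eq by (metis inf.boundedI inf.cobounded1)
  moreover have "inf (- a) u \<le> inf (- a) (- b)"
    using inf_compl_cong[OF eq] by (metis inf.boundedI inf.cobounded1)
  moreover have "u = sup (inf a u) (inf (- a) u)"
    by (simp flip: inf_sup_distrib2)
  ultimately show "u \<le> sup (inf a b) (inf (- a) (- b))"
    by (metis sup.mono)
qed

section \<open>Terms on a part, and 0-1 points\<close>

lemma eval_term_cong:
  "(\<And>x. x \<in> tvars t \<Longrightarrow> p x = q x) \<Longrightarrow> eval_term c p t = eval_term c q t"
  by (induction t) auto

text \<open>Meeting with \<open>u\<close> is a homomorphism onto the boolean algebra of elements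
  below \<open>u\<close>, in which the complement of \<open>a\<close> is
  \<open>inf (- a) u\<close>.\<close>

lemma inf_eval_term_cong:
  "(\<And>x. x \<in> tvars t \<Longrightarrow> inf (p x) u = inf (q x) u) \<Longrightarrow>
    inf (eval_term c p t) u = inf (eval_term c q t) u"
proof (induction t)
  case (TAnd t s)
  then have "inf (inf (eval_term c p t) u) (inf (eval_term c p s) u) =
      inf (inf (eval_term c q t) u) (inf (eval_term c q s) u)"
    by simp
  then show ?case by (simp add: ac_simps)
qed (auto simp: inf_sup_distrib2 intro: inf_compl_cong)

text \<open>The vector \<open>\<alpha>\<close> is kept apart from the algebra, so that the same
  vector can be read in both algebras.\<close>

definition boolean_point :: "(nat \<Rightarrow> bool) \<Rightarrow> nat \<Rightarrow> 'a::boolean_algebra" where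
  "boolean_point \<alpha> x = (if \<alpha> x then top else bot)"

text \<open>Induction on \<open>X\<close>: each new value \<open>p y\<close> splits the part found
  so far in two, and a nonzero half is kept.\<close>

lemma exists_boolean_part:
  fixes p :: "nat \<Rightarrow> 'a::boolean_algebra"
  assumes "finite X" "v \<noteq> bot"
  obtains u \<alpha> where "u \<noteq> bot" "u \<le> v" "\<And>x. x \<in> X \<Longrightarrow> inf (p x) u = inf (boolean_point \<alpha> x) u"
proof -
  from assms(1)
  have "\<exists>u \<alpha>. u \<noteq> bot \<and> u \<le> v \<and> (\<forall>x\<in>X. inf (p x) u = inf (boolean_point \<alpha> x) u)"
  proof induction
    case empty
    then show ?case using assms(2) by blast
  next
    case (insert y X)
    then obtain u \<alpha> where u: "u \<noteq> bot" "u \<le> v"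
      and X: "\<forall>x\<in>X. inf (p x) u = inf (boolean_point \<alpha> x) u"
      by blast
    have step: ?case
      if w: "w = inf (if b then p y else - p y) u" "w \<noteq> bot" for w b
    proof (intro exI conjI ballI)
      show "w \<noteq> bot" "w \<le> v"
        using w u by (auto intro: le_infI2)
      fix x assume x: "x \<in> insert y X"
      show "inf (p x) w = inf (boolean_point (\<alpha>(y := b)) x) w"
      proof (cases "x = y")
        case True
        then show ?thesis
          by (auto simp: w(1) boolean_point_def inf.assoc[symmetric])
      next
        case False
        \<comment> \<open>Since \<open>w\<close> lies below \<open>u\<close>, agreement on
          \<open>u\<close> passes to \<open>w\<close>.\<close>
        have "inf z w = inf (inf z u) w" for z
          by (simp add: w(1) ac_simps)
        moreover have "inf (p x) u = inf (boolean_point (\<alpha>(y := b)) x) u"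
          using X x False by (simp add: boolean_point_def)
        ultimately show ?thesis by metis
      qed
    qed
    have "inf (p y) u \<noteq> bot \<or> inf (- p y) u \<noteq> bot"
    proof (rule ccontr)
      assume "\<not> ?thesis"
      then have "sup (inf (p y) u) (inf (- p y) u) = bot" by simp
      then show False using u(1) by (simp flip: inf_sup_distrib2)
    qed
    then show ?case
      using step[OF refl, of True] step[OF refl, of False] by auto
  qed
  then show ?thesis using that by blast
qed

section \<open>Carrying a violated equation from one algebra to the other\<close>

definition biimplication :: "('v, 'i) bterm \<Rightarrow> ('v, 'i) bterm \<Rightarrow> ('v, 'i) bterm" where
  "biimplication t s = TOr (TAnd t s) (TAnd (TNot t) (TNot s))"

text \<open>Turns agreement on \<open>u\<close> into a lower bound condition, the form in which
  infima can be applied.\<close>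

lemma le_eval_biimplication_iff:
  "u \<le> eval_term c p (biimplication t s) \<longleftrightarrow>
    inf (eval_term c p t) u = inf (eval_term c p s) u"
  by (simp add: biimplication_def le_biimplication_iff)

lemma tconsts_biimplication [simp]: "tconsts (biimplication t s) = tconsts t \<union> tconsts s"
  by (auto simp: biimplication_def)

lemma tvars_biimplication [simp]: "tvars (biimplication t s) = tvars t \<union> tvars s"
  by (auto simp: biimplication_def)

text \<open>The infimum hypothesis speaks of terms at 0-1 points instead of sets of constants. This
  does not mention \<open>h\<close>, so the lemma can be applied with the algebras
  exchanged.\<close>

lemma radical_mono:
  fixes c1 :: "'i \<Rightarrow> 'a::boolean_algebra" and c2 :: "'i \<Rightarrow> 'b::boolean_algebra"
  assumes sys: "is_system I X S"
    and inc: "inconsistent c1 X S \<Longrightarrow> inconsistent c2 X S"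
    and glb: "\<And>\<alpha> T. (\<And>t. t \<in> T \<Longrightarrow> tconsts t \<subseteq> I) \<Longrightarrow>
      isGlb UNIV (eval_term c1 (boolean_point \<alpha>) ` T) bot \<Longrightarrow>
      isGlb UNIV (eval_term c2 (boolean_point \<alpha>) ` T) bot"
  shows "radical I c1 X S \<subseteq> radical I c2 X S"
proof clarify
  fix t s assume ts: "(t, s) \<in> radical I c1 X S"
  then have terms: "t \<in> terms_in I X" "s \<in> terms_in I X"
    by (auto simp: radical_def equations_in_def)
  have finX: "finite X" using sys by (simp add: is_system_def)
  have S_terms: "tvars l \<union> tvars r \<subseteq> X" "tconsts l \<union> tconsts r \<subseteq> I" if "(l, r) \<in> S" for l r
    using that sys by (auto simp: is_system_def equations_in_def terms_in_def)
  let ?f = "TNot (biimplication t s)"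
  have "p \<in> solutions c2 X {(t, s)}" if p: "p \<in> solutions c2 X S" for p
  proof (rule ccontr)
    assume "p \<notin> solutions c2 X {(t, s)}"
    then have "eval_term c2 p t \<noteq> eval_term c2 p s"
      using p by (auto simp: solutions_def)
    \<comment> \<open>The value of \<open>?f\<close> at \<open>p\<close> is the part on which
      \<open>p\<close> violates the equation.\<close>
    then have "eval_term c2 p ?f \<noteq> bot"
      using le_eval_biimplication_iff[of top c2 p t s] by (metis compl_bot_eq double_compl eval_term.simps(7) inf_top_right order_refl)
    then obtain u \<alpha> where u: "u \<noteq> bot" "u \<le> eval_term c2 p ?f"
      and \<alpha>: "\<And>x. x \<in> X \<Longrightarrow> inf (p x) u = inf (boolean_point \<alpha> x) u"
      using exists_boolean_part[OF finX] by metis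
    have eval_p: "inf (eval_term c2 p r) u = inf (eval_term c2 (boolean_point \<alpha>) r) u"
      if "tvars r \<subseteq> X" for r
      using that \<alpha> by (intro inf_eval_term_cong) auto
    \<comment> \<open>The lower bounds of the values of \<open>T\<close> at \<open>\<alpha>\<close>
      are the parts on which \<open>\<alpha>\<close> solves \<open>S\<close> while \<open>t\<close>
      and \<open>s\<close> take complementary values.\<close>
    define T where "T = insert ?f ((\<lambda>(l, r). biimplication l r) ` S)"
    have T_I: "tconsts r \<subseteq> I" if "r \<in> T" for r
      using that terms by (auto simp: T_def terms_in_def dest!: S_terms(2))
    have "u \<le> eval_term c2 (boolean_point \<alpha>) r" if "r \<in> T" for r
    proof -
      have "tvars r \<subseteq> X"
        using that terms by (auto simp: T_def terms_in_def dest!: S_terms(1))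
      moreover have "u \<le> eval_term c2 p r"
        using that u(2) p unfolding T_def
        by (auto simp: le_eval_biimplication_iff solutions_def)
      ultimately show ?thesis using eval_p by (metis inf.absorb_iff2)
    qed
    then have "\<not> isGlb UNIV (eval_term c2 (boolean_point \<alpha>) ` T) bot"
      using u(1) by (auto simp: isGlb_UNIV_bot_iff)
    then have "\<not> isGlb UNIV (eval_term c1 (boolean_point \<alpha>) ` T) bot"
      using glb T_I by blast
    then obtain w where w: "w \<noteq> bot" "\<And>r. r \<in> T \<Longrightarrow> w \<le> eval_term c1 (boolean_point \<alpha>) r"
      by (auto simp: isGlb_UNIV_bot_iff)
    obtain q where q: "q \<in> solutions c1 X S"
      using inc p by (auto simp: inconsistent_def)
    \<comment> \<open>This is \<open>\<alpha>\<close> on \<open>w\<close> and \<open>q\<close> off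
      \<open>w\<close>, so each equation of \<open>S\<close> can be checked on the two parts
      separately.\<close>
    define q' where "q' = restrict (\<lambda>x. sup (inf (boolean_point \<alpha> x) w) (inf (q x) (- w))) X"
    have in_w: "inf (eval_term c1 q' r) w = inf (eval_term c1 (boolean_point \<alpha>) r) w"
      if "tvars r \<subseteq> X" for r
      using that by (intro inf_eval_term_cong) (auto simp: q'_def inf_sup_distrib2 inf.assoc)
    have off_w: "inf (eval_term c1 q' r) (- w) = inf (eval_term c1 q r) (- w)"
      if "tvars r \<subseteq> X" for r
      using that by (intro inf_eval_term_cong) (auto simp: q'_def inf_sup_distrib2 inf.assoc)
    have "eval_term c1 q' l = eval_term c1 q' r" if lr: "(l, r) \<in> S" for l r
    proof (rule eq_if_inf_eq_both_parts)
      have "w \<le> eval_term c1 (boolean_point \<alpha>) (biimplication l r)"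
        by (rule w(2)) (use lr in \<open>force simp: T_def\<close>)
      then show "inf (eval_term c1 q' l) w = inf (eval_term c1 q' r) w"
        using in_w S_terms(1)[OF lr] by (simp add: le_eval_biimplication_iff)
      show "inf (eval_term c1 q' l) (- w) = inf (eval_term c1 q' r) (- w)"
        using off_w S_terms(1)[OF lr] q lr by (auto simp: solutions_def)
    qed
    then have "q' \<in> solutions c1 X S"
      by (auto simp: solutions_def q'_def)
    then have "eval_term c1 q' t = eval_term c1 q' s"
      using ts by (auto simp: radical_def solutions_def)
    then have "eval_term c1 q' ?f = bot"
      using le_eval_biimplication_iff[of top c1 q' t s] by (simp add: top_unique)
    moreover have "inf (eval_term c1 q' ?f) w = w"
      using in_w[of ?f] w(2)[of ?f] terms by (auto simp: T_def terms_in_def inf_absorb2)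
    ultimately show False using w(1) by simp
  qed
  then show "(t, s) \<in> radical I c2 X S"
    using terms by (auto simp: radical_def equations_in_def)
qed

text \<open>Variables do no harm here: a 0-1 point gives them only the values \<open>bot\<close> and
  \<open>top\<close>, which \<open>h\<close> preserves.\<close>

lemma const_isomorphism_eval:
  assumes iso: "const_isomorphism I c1 c2 h" and "tconsts t \<subseteq> I"
  shows "eval_term c1 (boolean_point \<alpha>) t \<in> const_subalgebra I c1 \<and>
    h (eval_term c1 (boolean_point \<alpha>) t) = eval_term c2 (boolean_point \<alpha>) t"
  using assms(2)
  by (induction t)
    (use iso in \<open>auto simp: const_isomorphism_def const_subalgebra_def boolean_point_def
      intro: generated_subalgebra.intros\<close>)

section \<open>Expressing the two conditions through radicals\<close>

lemma const_subalgebra_closed_term: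
  assumes "d \<in> const_subalgebra I c"
  obtains t :: "(nat, 'i) bterm"
    where "t \<in> terms_in I {}" "\<And>p. eval_term c p t = d"
proof -
  from assms[unfolded const_subalgebra_def]
  have "\<exists>t :: (nat, 'i) bterm. t \<in> terms_in I {} \<and> (\<forall>p. eval_term c p t = d)"
  proof induction
    case (gen_base a)
    then obtain i where "i \<in> I" "a = c i" by blast
    then show ?case by (intro exI[of _ "TConst i"]) (auto simp: terms_in_def)
  next
    case gen_bot
    show ?case by (intro exI[of _ TZero]) (auto simp: terms_in_def)
  next
    case gen_top
    show ?case by (intro exI[of _ TOne]) (auto simp: terms_in_def)
  next
    case (gen_sup a b)
    then obtain t s :: "(nat, 'i) bterm" where
      "t \<in> terms_in I {} \<and> (\<forall>p. eval_term c p t = a)" "s \<in> terms_in I {} \<and> (\<forall>p. eval_term c p s = b)"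
      by blast
    then show ?case by (intro exI[of _ "TOr t s"]) (auto simp: terms_in_def)
  next
    case (gen_inf a b)
    then obtain t s :: "(nat, 'i) bterm" where
      "t \<in> terms_in I {} \<and> (\<forall>p. eval_term c p t = a)" "s \<in> terms_in I {} \<and> (\<forall>p. eval_term c p s = b)"
      by blast
    then show ?case by (intro exI[of _ "TAnd t s"]) (auto simp: terms_in_def)
  next
    case (gen_compl a)
    then obtain t :: "(nat, 'i) bterm" where "t \<in> terms_in I {} \<and> (\<forall>p. eval_term c p t = a)"
      by blast
    then show ?case by (intro exI[of _ "TNot t"]) (auto simp: terms_in_def)
  qed
  then show ?thesis using that by blast
qed

text \<open>No point of a nontrivial algebra satisfies \<open>0 = 1\<close>, so this equation
  follows only from systems without solutions.\<close>

lemma inconsistent_iff_radical: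
  fixes c :: "'i \<Rightarrow> 'a::boolean_algebra"
  assumes "(bot :: 'a) \<noteq> top"
  shows "inconsistent c X S \<longleftrightarrow> (TZero, TOne) \<in> radical I c X S"
  using assms by (auto simp: inconsistent_def radical_def solutions_def equations_in_def terms_in_def)

lemma not_inconsistent_trivial:
  fixes c :: "'i \<Rightarrow> 'a::boolean_algebra"
  assumes "(bot :: 'a) = top"
  shows "\<not> inconsistent c X S"
proof -
  have "a = b" for a b :: 'a
    using assms by (metis bot_least top_greatest order_antisym)
  then have "restrict (\<lambda>_. bot) X \<in> solutions c X S"
    unfolding solutions_def by blast
  then show ?thesis by (auto simp: inconsistent_def)
qed

text \<open>For closed terms, the solutions are the common lower bounds of the constants that
  \<open>T\<close> names.\<close>

definition lower_bound_system :: "(nat, 'i) bterm set \<Rightarrow> 'i equation set" where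
  "lower_bound_system T = (\<lambda>t. (TAnd (TVar 0) t, TVar 0)) ` T"

text \<open>The infimum is \<open>bot\<close> exactly when every lower bound is \<open>bot\<close>,
  that is, when the system forces its variable to be \<open>0\<close>. The assignment
  \<open>r\<close> is arbitrary because the terms are closed.\<close>

lemma isGlb_iff_radical:
  fixes c :: "'i \<Rightarrow> 'a::boolean_algebra"
  assumes T: "T \<subseteq> terms_in I {}"
  shows "isGlb UNIV (eval_term c r ` T) bot \<longleftrightarrow>
    (TVar 0, TZero) \<in> radical I c {0} (lower_bound_system T)"
proof -
  have closed: "eval_term c p t = eval_term c r t" if "t \<in> T" for p t
    using T that by (intro eval_term_cong) (auto simp: terms_in_def)
  have sol: "p \<in> solutions c {0} (lower_bound_system T) \<longleftrightarrow>
      p \<in> {0} \<rightarrow>\<^sub>E UNIV \<and> (\<forall>t\<in>T. p 0 \<le> eval_term c r t)" for p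
    by (auto simp: solutions_def lower_bound_system_def inf.absorb_iff1 closed[of _ p])
  have "(TVar 0, TZero) \<in> radical I c {0} (lower_bound_system T) \<longleftrightarrow>
      (\<forall>p \<in> {0::nat} \<rightarrow>\<^sub>E UNIV. (\<forall>t\<in>T. p 0 \<le> eval_term c r t) \<longrightarrow> p 0 = bot)"
    unfolding radical_def subset_iff sol
    by (auto simp: solutions_def equations_in_def terms_in_def)
  also have "\<dots> \<longleftrightarrow> (\<forall>u. (\<forall>t\<in>T. u \<le> eval_term c r t) \<longrightarrow> u = bot)"
  proof (intro iffI allI impI ballI)
    fix u
    assume "\<forall>p \<in> {0::nat} \<rightarrow>\<^sub>E UNIV. (\<forall>t\<in>T. p 0 \<le> eval_term c r t) \<longrightarrow> p 0 = bot"
      and "\<forall>t\<in>T. u \<le> eval_term c r t"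
    then show "u = bot"
      by (auto dest!: bspec[of _ _ "restrict (\<lambda>_. u) {0}"] split: if_splits)
  qed auto
  finally show ?thesis by (simp add: isGlb_UNIV_bot_iff)
qed

lemma is_system_lower_bound_system:
  "T \<subseteq> terms_in I {} \<Longrightarrow> is_system I {0} (lower_bound_system T)"
  by (force simp: is_system_def lower_bound_system_def equations_in_def terms_in_def)

theorem theorem7p2:
  fixes I :: "'i set"
    and c1 :: "'i \<Rightarrow> 'a::boolean_algebra"
    and c2 :: "'i \<Rightarrow> 'b::boolean_algebra"
    and h :: "'a \<Rightarrow> 'b"
  assumes "const_isomorphism I c1 c2 h"
  shows "geometrically_equivalent I c1 c2 \<longleftrightarrow>
    (\<forall>X S. is_system I X S \<longrightarrow> (inconsistent c1 X S \<longleftrightarrow> inconsistent c2 X S)) \<and>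
    (\<forall>D. D \<subseteq> const_subalgebra I c1 \<longrightarrow> (isGlb UNIV D bot \<longleftrightarrow> isGlb UNIV (h ` D) bot))"
    (is "?geom \<longleftrightarrow> ?incons \<and> ?glb")
proof (intro iffI conjI)
  assume geom: ?geom
  \<comment> \<open>By injectivity of \<open>h\<close> both algebras are trivial or neither is. In
    the trivial case all systems are consistent; otherwise \<open>0 = 1\<close> detects
    inconsistency in both.\<close>
  have "(bot :: 'a) = top \<longleftrightarrow> (bot :: 'b) = top"
  proof -
    have "inj_on h (const_subalgebra I c1)" "h bot = bot" "h top = top"
      using assms by (auto simp: const_isomorphism_def bij_betw_def)
    moreover have "bot \<in> const_subalgebra I c1" "top \<in> const_subalgebra I c1"
      by (auto simp: const_subalgebra_def intro: generated_subalgebra.intros)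
    ultimately show ?thesis using inj_on_eq_iff[of h _ bot top] by auto
  qed
  then show ?incons
    using geom inconsistent_iff_radical[where 'a='a] inconsistent_iff_radical[where 'a='b]
      not_inconsistent_trivial[where 'a='a] not_inconsistent_trivial[where 'a='b]
    unfolding geometrically_equivalent_def by metis
  show ?glb
  proof (intro allI impI)
    fix D assume D: "D \<subseteq> const_subalgebra I c1"
    \<comment> \<open>Closed terms have the same value at every point; 0-1 points are chosen so that
      \<open>const_isomorphism_eval\<close> applies.\<close>
    define r1 :: "nat \<Rightarrow> 'a" where "r1 = boolean_point (\<lambda>_. True)"
    define r2 :: "nat \<Rightarrow> 'b" where "r2 = boolean_point (\<lambda>_. True)"
    define T where "T = {t \<in> terms_in I {}. eval_term c1 r1 t \<in> D}"
    have T: "T \<subseteq> terms_in I {}" by (auto simp: T_def)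
    have D_eq: "D = eval_term c1 r1 ` T"
    proof
      show "D \<subseteq> eval_term c1 r1 ` T"
      proof
        fix d assume d: "d \<in> D"
        then obtain t :: "(nat, 'i) bterm" where "t \<in> terms_in I {}" "eval_term c1 r1 t = d"
          using D const_subalgebra_closed_term by (metis subsetD)
        then show "d \<in> eval_term c1 r1 ` T" using d by (auto simp: T_def)
      qed
    qed (auto simp: T_def)
    have "h (eval_term c1 r1 t) = eval_term c2 r2 t" if "t \<in> T" for t
      using const_isomorphism_eval[OF assms, of t] that T
      by (auto simp: r1_def r2_def terms_in_def)
    then have hD_eq: "h ` D = eval_term c2 r2 ` T"
      by (simp add: D_eq image_image)
    show "isGlb UNIV D bot \<longleftrightarrow> isGlb UNIV (h ` D) bot"
      unfolding hD_eq unfolding D_eq isGlb_iff_radical[OF T]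
      using geom is_system_lower_bound_system[OF T] by (simp add: geometrically_equivalent_def)
  qed
next
  assume conds: "?incons \<and> ?glb"
  \<comment> \<open>At a 0-1 point the values of \<open>T\<close> are constants, and
    \<open>h\<close> maps them to the values in the other algebra, so condition (2) applies.\<close>
  have glb: "isGlb UNIV (eval_term c1 (boolean_point \<alpha>) ` T) bot \<longleftrightarrow>
      isGlb UNIV (eval_term c2 (boolean_point \<alpha>) ` T) bot"
    if "\<And>t. t \<in> T \<Longrightarrow> tconsts t \<subseteq> I" for \<alpha> and T :: "(nat, 'i) bterm set"
  proof -
    have "eval_term c1 (boolean_point \<alpha>) ` T \<subseteq> const_subalgebra I c1"
      "h ` eval_term c1 (boolean_point \<alpha>) ` T = eval_term c2 (boolean_point \<alpha>) ` T"
      using const_isomorphism_eval[OF assms] that by (auto simp: image_image)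
    then show ?thesis using conds by metis
  qed
  show ?geom
    unfolding geometrically_equivalent_def
    using conds glb by (intro allI impI equalityI radical_mono) auto
qed

end
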